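(* Let $\mu$ be a quasi-definite complex Borel measure on $\mathbb T$, with CMV bi-orthogonal Laurent polynomials $\varphi_a^{(l)}(z)=\sum_k\varphi_{a,k}^{(l)}z^k$ (finite sums), $a=1,2$. Then for all $l\ge0$ the partial second kind functions are $$C_{1,1}^{(l)}(z)=2\pi\sum_{k}\varphi^{(l)}_{2,k}z^{-k-1}\bar F^{(-)}_{\mu,-k-1}(z),\quad R_-<|z|<\infty,$$ $$C_{1,2}^{(l)}(z)=2\pi\sum_{k}\varphi^{(l)}_{2,k}z^{-k-1}\bar F^{(+)}_{\mu,-k-1}(z),\quad 0<|z|<R_+,$$ $$C_{2,1}^{(l)}(z)=2\pi\sum_{k}\varphi^{(l)}_{1,k}z^{-k-1}F^{(+)}_{\mu,k}(z^{-1}),\quad R_+^{-1}<|z|<\infty,$$ $$C_{2,2}^{(l)}(z)=2\pi\sum_{k}\varphi^{(l)}_{1,k}z^{-k-1}F^{(-)}_{\mu,k}(z^{-1}),\quad 0<|z|<R_-^{-1},$$ and the second kind functions are $$C_1^{(l)}(z)=2\pi\varphi_2^{(l)}(z^{-1})z^{-1}\bar F_\mu(z),\quad R_-<|z|<R_+,$$ $$C_2^{(l)}(z)=2\pi\varphi_1^{(l)}(z^{-1})z^{-1}F_\mu(z^{-1}),\quad R_+^{-1}<|z|<R_-^{-1}.$$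
   Context: $\mathbb T$ is the unit circle. $\mu$ is quasi-definite if all Toeplitz matrices $\big(\oint_{\mathbb T}z^{i-j}d\mu\big)_{i,j=0}^n$, $n\ge0$, are non-singular. Indices start at $0$; $\dagger$ is the conjugate transpose. $\oint_{\mathbb T}f\,d\mu$ is the integral of $f$ against $\mu$. $\chi_1(z)=(1,0,z,0,z^2,\dots)^\top$, $\chi_2(z)=(0,1,0,z,0,z^2,\dots)^\top$, $\chi_a^*(z)=z^{-1}\chi_a(z^{-1})$; $\chi=\chi_1+\chi_2^*=(1,z^{-1},z,z^{-2},\dots)^\top$, $\chi^*=\chi_1^*+\chi_2=(z^{-1},1,z^{-2},z,\dots)^\top$. $g=\oint_{\mathbb T}\chi\chi^\dagger d\mu=S_1^{-1}S_2$ with $S_1$ lower unitriangular and $S_2$ upper triangular (unique). $\varphi_1^{(l)}=(S_1\chi)^{(l)}$, $\varphi_2^{(l)}=((S_2^{-1})^\dagger\chi)^{(l)}$. Second kind functions (defined as the series given by the matrix products): $C_{1,1}=(S_1^{-1})^\dagger\chi_1^*$, $C_{1,2}=(S_1^{-1})^\dagger\chi_2$, $C_{2,1}=S_2\chi_1^*$, $C_{2,2}=S_2\chi_2$, $C_1=(S_1^{-1})^\dagger\chi^*=C_{1,1}+C_{1,2}$, $C_2=S_2\chi^*=C_{2,1}+C_{2,2}$; the superscript $(l)$ denotes the $l$-th component. Fourier data: $c_n=\frac1{2\pi}\int_0^{2\pi}e^{-in\theta}d\mu(\theta)$, $F_\mu(z)=\sum_{n\in\mathbb Z}c_nz^n$,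 $F^{(+)}_{\mu,k}(z)=\sum_{n\ge-k}c_nz^n$, $F^{(-)}_{\mu,k}(z)=\sum_{n<-k}c_nz^n$. A bar over such a series or a Laurent polynomial denotes conjugation of its coefficients only, e.g. $\bar F_\mu(z)=\sum_n\overline{c_n}z^n$. $R_+=(\limsup_{n\to\infty}|c_n|^{1/n})^{-1}$, $R_-=\limsup_{n\to\infty}|c_{-n}|^{1/n}$. (If an annulus is empty the corresponding claim is vacuous.) *)

theory Defs
  imports "HOL-Analysis.Analysis" "Jordan_Normal_Form.Determinant"
begin

text \<open>
  A complex measure is a countably additive complex-valued set function. It is given as a bare
  function on sets; the first argument \<open>M\<close> only supplies the underlying space and sigma-algebra.
\<close>

definition complex_measure :: "'a measure \<Rightarrow> ('a set \<Rightarrow> complex) \<Rightarrow> bool" where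
  "complex_measure M \<mu> \<longleftrightarrow>
     (\<forall>A :: nat \<Rightarrow> 'a set. range A \<subseteq> sets M \<longrightarrow> disjoint_family A \<longrightarrow>
        (\<lambda>i. \<mu> (A i)) sums \<mu> (\<Union>i. A i))"

text \<open>
  For a signed measure \<open>\<nu>\<close>, \<open>upper_variation M \<nu>\<close> is the positive part of the Jordan decomposition
  of \<open>\<nu>\<close>, and \<open>upper_variation M (\<lambda>A. - \<nu> A)\<close> is the negative part. Negative values of \<open>\<nu>\<close>
  are sent to 0 by \<^const>\<open>ennreal\<close>, which does not change the supremum because \<open>\<nu> {} = 0\<close>.
\<close>

definition upper_variation :: "'a measure \<Rightarrow> ('a set \<Rightarrow> real) \<Rightarrow> 'a measure" where
  "upper_variation M \<nu> =
     measure_of (space M) (sets M) (\<lambda>A. SUP B \<in> {B \<in> sets M. B \<subseteq> A}. ennreal (\<nu> B))"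

definition signed_integral :: "'a measure \<Rightarrow> ('a set \<Rightarrow> real) \<Rightarrow> ('a \<Rightarrow> complex) \<Rightarrow> complex" where
  "signed_integral M \<nu> f =
     integral\<^sup>L (upper_variation M \<nu>) f - integral\<^sup>L (upper_variation M (\<lambda>A. - \<nu> A)) f"

definition complex_integral :: "'a measure \<Rightarrow> ('a set \<Rightarrow> complex) \<Rightarrow> ('a \<Rightarrow> complex) \<Rightarrow> complex" where
  "complex_integral M \<mu> f =
     signed_integral M (\<lambda>A. Re (\<mu> A)) f + \<i> * signed_integral M (\<lambda>A. Im (\<mu> A)) f"

lemma emeasure_upper_variation:
  fixes \<nu> :: "'a set \<Rightarrow> real"
  assumes ca: "\<And>A :: nat \<Rightarrow> 'a set. range A \<subseteq> sets M \<Longrightarrow> disjoint_family A \<Longrightarrow>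
                 (\<lambda>i. \<nu> (A i)) sums \<nu> (\<Union>i. A i)"
    and A: "A \<in> sets M"
  shows "emeasure (upper_variation M \<nu>) A = (SUP B \<in> {B \<in> sets M. B \<subseteq> A}. ennreal (\<nu> B))"
proof -
  define f where "f A = (SUP B \<in> {B \<in> sets M. B \<subseteq> A}. ennreal (\<nu> B))" for A
  have empty: "\<nu> {} = 0"
  proof -
    have "(\<lambda>i::nat. \<nu> {}) sums \<nu> {}"
      using ca[of "\<lambda>_. {}"] by (auto simp: disjoint_family_on_def)
    then have "(\<lambda>i::nat. \<nu> {}) \<longlonglongrightarrow> 0"
      using summable_LIMSEQ_zero sums_summable by blast
    then show ?thesis by (simp add: LIMSEQ_const_iff)
  qed
  have add: "\<nu> (B \<union> C) = \<nu> B + \<nu> C" if "B \<in> sets M" "C \<in> sets M" "B \<inter> C = {}" for B C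
  proof -
    have "(\<lambda>i. \<nu> (binaryset B C i)) sums \<nu> (\<Union>i. binaryset B C i)"
      using that by (intro ca) (auto simp: range_binaryset_eq disjoint_family_on_def binaryset_def)
    moreover have "(\<lambda>i. \<nu> (binaryset B C i)) sums (\<nu> B + \<nu> C)"
      using empty by (rule binaryset_sums)
    ultimately show ?thesis
      by (simp add: UN_binaryset_eq sums_unique2)
  qed
  have upper: "ennreal (\<nu> B) \<le> f A" if "B \<in> sets M" "B \<subseteq> A" for A B
    unfolding f_def using that by (intro SUP_upper) auto
  have mono: "f A \<le> f B" if "A \<subseteq> B" for A B
    unfolding f_def using that by (intro SUP_subset_mono) auto
  have super: "f A + f B \<le> f (A \<union> B)" if "A \<inter> B = {}" for A B
  proof -
    have 1: "ennreal (\<nu> C) + ennreal (\<nu> D) \<le> f (A \<union> B)"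
      if C: "C \<in> sets M" "C \<subseteq> A" and D: "D \<in> sets M" "D \<subseteq> B" for C D
    proof (cases "\<nu> C \<ge> 0 \<and> \<nu> D \<ge> 0")
      case True
      have "C \<inter> D = {}" using C D \<open>A \<inter> B = {}\<close> by auto
      then have "ennreal (\<nu> C) + ennreal (\<nu> D) = ennreal (\<nu> (C \<union> D))"
        using True add[of C D] C D by (simp add: ennreal_plus)
      also have "\<dots> \<le> f (A \<union> B)" using C D by (intro upper) auto
      finally show ?thesis .
    next
      case False
      then have "ennreal (\<nu> C) = 0 \<or> ennreal (\<nu> D) = 0"
        by (auto simp: ennreal_neg)
      moreover have "C \<subseteq> A \<union> B" "D \<subseteq> A \<union> B" using C D by auto
      ultimately show ?thesis
        using upper[OF C(1)] upper[OF D(1)] by (auto simp del: ennreal_eq_0_iff)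
    qed
    have ne: "{C \<in> sets M. C \<subseteq> A} \<noteq> {}" for A by auto
    have 2: "ennreal (\<nu> C) + f B \<le> f (A \<union> B)" if "C \<in> sets M" "C \<subseteq> A" for C
    proof -
      have "ennreal (\<nu> C) + f B = (SUP D \<in> {D \<in> sets M. D \<subseteq> B}. ennreal (\<nu> C) + ennreal (\<nu> D))"
        unfolding f_def[of B] by (rule ennreal_SUP_add_right[OF ne])
      also have "\<dots> \<le> f (A \<union> B)" using 1 that by (intro SUP_least) auto
      finally show ?thesis .
    qed
    have "f B + ennreal (\<nu> C) \<le> f (A \<union> B)" if "C \<in> sets M" "C \<subseteq> A" for C
      using 2[OF that] by (simp add: add.commute)
    then have "(SUP C \<in> {C \<in> sets M. C \<subseteq> A}. f B + ennreal (\<nu> C)) \<le> f (A \<union> B)"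
      by (intro SUP_least) auto
    then have "f B + f A \<le> f (A \<union> B)"
      unfolding f_def[of A] ennreal_SUP_add_right[OF ne] .
    then show ?thesis by (simp add: add.commute)
  qed
  have pos: "positive (sets M) f"
  proof -
    have "{B. B \<in> sets M \<and> B = {}} = {{}}" by auto
    then show ?thesis by (simp add: positive_def f_def empty)
  qed
  have "countably_additive (sets M) f"
    unfolding countably_additive_def
  proof (intro allI impI)
    fix S :: "nat \<Rightarrow> 'a set"
    assume S: "range S \<subseteq> sets M" "disjoint_family S" "(\<Union>i. S i) \<in> sets M"
    show "(\<Sum>i. f (S i)) = f (\<Union>i. S i)"
    proof (rule antisym)
      have fin: "(\<Sum>i<n. f (S i)) \<le> f (\<Union>i<n. S i)" for n
      proof (induction n)
        case (Suc n)
        have "S i \<inter> S n = {}" if "i < n" for i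
          using disjoint_family_onD[OF S(2), of i n] that by simp
        then have "(\<Union>i<n. S i) \<inter> S n = {}" by blast
        then have "f (\<Union>i<n. S i) + f (S n) \<le> f ((\<Union>i<n. S i) \<union> S n)"
          by (rule super)
        moreover have "(\<Union>i<n. S i) \<union> S n = (\<Union>i<Suc n. S i)"
          by (auto simp: less_Suc_eq)
        moreover have "(\<Sum>i<Suc n. f (S i)) \<le> f (\<Union>i<n. S i) + f (S n)"
          using Suc.IH by (simp add: add_right_mono)
        ultimately show ?case
          by (metis order_trans)
      qed simp
      show "(\<Sum>i. f (S i)) \<le> f (\<Union>i. S i)"
      proof (rule suminf_le_const)
        show "(\<Sum>i<n. f (S i)) \<le> f (\<Union>i. S i)" for n
          by (rule order_trans[OF fin mono]) auto
      qed simp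
    next
      show "f (\<Union>i. S i) \<le> (\<Sum>i. f (S i))"
        unfolding f_def[of "\<Union>i. S i"]
      proof (rule SUP_least)
        fix B assume "B \<in> {B \<in> sets M. B \<subseteq> (\<Union>i. S i)}"
        then have B: "B \<in> sets M" "B \<subseteq> (\<Union>i. S i)" by auto
        have "(\<lambda>i. \<nu> (B \<inter> S i)) sums \<nu> (\<Union>i. B \<inter> S i)"
          using S B by (intro ca disjoint_family_on_bisimulation[OF S(2)]) auto
        moreover have "(\<Union>i. B \<inter> S i) = B" using B by auto
        ultimately have lim: "(\<lambda>n. \<Sum>i<n. \<nu> (B \<inter> S i)) \<longlonglongrightarrow> \<nu> B"
          by (simp add: sums_def)
        have "ennreal (\<Sum>i<n. \<nu> (B \<inter> S i)) \<le> (\<Sum>i. f (S i))" for n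
        proof -
          have "ennreal (\<Sum>i<n. \<nu> (B \<inter> S i)) \<le> ennreal (\<Sum>i<n. max 0 (\<nu> (B \<inter> S i)))"
            by (intro ennreal_leI sum_mono) auto
          also have "\<dots> = (\<Sum>i<n. ennreal (max 0 (\<nu> (B \<inter> S i))))"
            by (simp add: sum_ennreal)
          also have "\<dots> = (\<Sum>i<n. ennreal (\<nu> (B \<inter> S i)))"
            by (intro sum.cong refl) (auto simp: max_def ennreal_neg)
          also have "\<dots> \<le> (\<Sum>i<n. f (S i))"
            using S B by (intro sum_mono upper) auto
          also have "\<dots> \<le> (\<Sum>i. f (S i))"
            by (intro sum_le_suminf) auto
          finally show ?thesis .
        qed
        then show "ennreal (\<nu> B) \<le> (\<Sum>i. f (S i))"
          by (intro LIMSEQ_le_const2[OF tendsto_ennrealI[OF lim]]) blast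
      qed
    qed
  qed
  then have "emeasure (measure_of (space M) (sets M) f) A = f A"
    using pos A by (intro emeasure_measure_of_sigma sets.sigma_algebra_axioms)
  then show ?thesis by (simp add: upper_variation_def f_def[abs_def])
qed

lemma complex_integral_of_real_measure:
  assumes "finite_measure M"
  shows "complex_integral M (\<lambda>A. complex_of_real (measure M A)) f = integral\<^sup>L M f"
proof -
  interpret finite_measure M by fact
  have sums: "(\<lambda>i. measure M (A i)) sums measure M (\<Union>i. A i)"
    if "range A \<subseteq> sets M" "disjoint_family A" for A :: "nat \<Rightarrow> 'a set"
    using finite_measure_UNION[OF that] .
  have 1: "upper_variation M (measure M) = M"
  proof (rule measure_eqI)
    fix A assume "A \<in> sets (upper_variation M (measure M))"
    then have A: "A \<in> sets M" by (simp add: upper_variation_def)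
    have "emeasure (upper_variation M (measure M)) A
            = (SUP B \<in> {B \<in> sets M. B \<subseteq> A}. ennreal (measure M B))"
      using sums A by (rule emeasure_upper_variation)
    also have "\<dots> = emeasure M A"
      using A by (intro antisym SUP_least SUP_upper2[of A])
        (auto simp: emeasure_eq_measure intro!: finite_measure_mono ennreal_leI)
    finally show "emeasure (upper_variation M (measure M)) A = emeasure M A" .
  qed (simp add: upper_variation_def)
  have null: "integral\<^sup>L (upper_variation M \<nu>) f = 0"
    if "\<And>A. \<nu> A \<le> 0" "\<And>A :: nat \<Rightarrow> 'a set. range A \<subseteq> sets M \<Longrightarrow> disjoint_family A \<Longrightarrow>
          (\<lambda>i. \<nu> (A i)) sums \<nu> (\<Union>i. A i)" for \<nu> :: "'a set \<Rightarrow> real"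
  proof -
    have "emeasure (upper_variation M \<nu>) (space M) = 0"
      using emeasure_upper_variation[of M \<nu> "space M"] that by (simp add: ennreal_neg SUP_constant bot_ennreal)
    moreover have "space (upper_variation M \<nu>) = space M"
      by (simp add: upper_variation_def)
    ultimately have "AE x in upper_variation M \<nu>. f x = 0"
      by (intro AE_I[where N = "space M"]) (auto simp: upper_variation_def)
    then show ?thesis by (rule integral_eq_zero_AE)
  qed
  show ?thesis
    using sums by (simp add: complex_integral_def signed_integral_def 1 null sums_minus)
qed

definition circle_borel :: "complex measure" where
  "circle_borel = restrict_space borel (sphere 0 1)"

definition circle_integral :: "(complex set \<Rightarrow> complex) \<Rightarrow> (complex \<Rightarrow> complex) \<Rightarrow> complex" where
  "circle_integral = complex_integral circle_borel"

definition toeplitz :: "(complex set \<Rightarrow> complex) \<Rightarrow> nat \<Rightarrow> complex Matrix.mat" where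
  "toeplitz \<mu> n =
     Matrix.mat (Suc n) (Suc n) (\<lambda>(i, j). circle_integral \<mu> (\<lambda>u. u powi (int i - int j)))"

definition quasi_definite :: "(complex set \<Rightarrow> complex) \<Rightarrow> bool" where
  "quasi_definite \<mu> \<longleftrightarrow> (\<forall>n. Determinant.det (toeplitz \<mu> n) \<noteq> 0)"

text \<open>\<open>e\<^sup>-\<^sup>i\<^sup>n\<^sup>\<theta>\<close> is \<open>u powi (- n)\<close> at the point \<open>u = e\<^sup>i\<^sup>\<theta>\<close> of the circle.\<close>

definition fourier_coeff :: "(complex set \<Rightarrow> complex) \<Rightarrow> int \<Rightarrow> complex" where
  "fourier_coeff \<mu> n = circle_integral \<mu> (\<lambda>u. u powi (- n)) / (2 * pi)"

text \<open>
  Formal Laurent series are given by their coefficients \<open>c\<close>; the bar over a series is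
  \<open>conj_coeffs\<close>. The three functions after it are \<open>F(z)\<close>, \<open>F\<^sup>(\<^sup>+\<^sup>)\<^sub>k(z)\<close> and
  \<open>F\<^sup>(\<^sup>-\<^sup>)\<^sub>k(z)\<close>, and \<open>R_plus\<close>, \<open>R_minus\<close> are the radii of convergence (the former
  is infinite if the limes superior vanishes).
\<close>

definition conj_coeffs :: "(int \<Rightarrow> complex) \<Rightarrow> int \<Rightarrow> complex" where
  "conj_coeffs c n = cnj (c n)"

definition F_full :: "(int \<Rightarrow> complex) \<Rightarrow> complex \<Rightarrow> complex" where
  "F_full c z = (\<Sum>\<^sub>\<infinity>n. c n * z powi n)"

definition F_plus :: "(int \<Rightarrow> complex) \<Rightarrow> int \<Rightarrow> complex \<Rightarrow> complex" where
  "F_plus c k z = (\<Sum>\<^sub>\<infinity>n\<in>{n. n \<ge> - k}. c n * z powi n)"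

definition F_minus :: "(int \<Rightarrow> complex) \<Rightarrow> int \<Rightarrow> complex \<Rightarrow> complex" where
  "F_minus c k z = (\<Sum>\<^sub>\<infinity>n\<in>{n. n < - k}. c n * z powi n)"

definition R_plus :: "(int \<Rightarrow> complex) \<Rightarrow> ereal" where
  "R_plus c = inverse (limsup (\<lambda>n. ereal (root n (cmod (c (int n))))))"

definition R_minus :: "(int \<Rightarrow> complex) \<Rightarrow> ereal" where
  "R_minus c = limsup (\<lambda>n. ereal (root n (cmod (c (- int n)))))"

text \<open>
  All matrices and vectors have rows and columns indexed by \<open>0, 1, 2, \<dots>\<close>; their products are
  series, which are finite sums as soon as one of the factors is suitably triangular.
\<close>

type_synonym imat = "nat \<Rightarrow> nat \<Rightarrow> complex"

definition imat_mult :: "imat \<Rightarrow> imat \<Rightarrow> imat" where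
  "imat_mult A B = (\<lambda>i j. \<Sum>k. A i k * B k j)"

definition imat_one :: imat where
  "imat_one = (\<lambda>i j. if i = j then 1 else 0)"

text \<open>
  The inverse is unique whenever \<open>A\<close> is lower or upper triangular with nonzero diagonal, which are
  the only cases used.
\<close>

definition imat_inv :: "imat \<Rightarrow> imat" where
  "imat_inv A = (THE B. imat_mult A B = imat_one \<and> imat_mult B A = imat_one)"

definition imat_dagger :: "imat \<Rightarrow> imat" where
  "imat_dagger A = (\<lambda>i j. cnj (A j i))"

definition imat_vec :: "imat \<Rightarrow> (nat \<Rightarrow> complex) \<Rightarrow> nat \<Rightarrow> complex" where
  "imat_vec A v l = (\<Sum>j. A l j * v j)"

definition imat_vec_converges :: "imat \<Rightarrow> (nat \<Rightarrow> complex) \<Rightarrow> nat \<Rightarrow> bool" where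
  "imat_vec_converges A v l \<longleftrightarrow> summable (\<lambda>j. A l j * v j)"

definition lower_unitriangular :: "imat \<Rightarrow> bool" where
  "lower_unitriangular A \<longleftrightarrow> (\<forall>i. A i i = 1) \<and> (\<forall>i j. i < j \<longrightarrow> A i j = 0)"

definition upper_triangular_imat :: "imat \<Rightarrow> bool" where
  "upper_triangular_imat A \<longleftrightarrow> (\<forall>i j. j < i \<longrightarrow> A i j = 0)"

definition chi1 :: "complex \<Rightarrow> nat \<Rightarrow> complex" where
  "chi1 z i = (if even i then z ^ (i div 2) else 0)"

definition chi2 :: "complex \<Rightarrow> nat \<Rightarrow> complex" where
  "chi2 z i = (if odd i then z ^ (i div 2) else 0)"

definition chi1_star :: "complex \<Rightarrow> nat \<Rightarrow> complex" where
  "chi1_star z i = inverse z * chi1 (inverse z) i"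

definition chi2_star :: "complex \<Rightarrow> nat \<Rightarrow> complex" where
  "chi2_star z i = inverse z * chi2 (inverse z) i"

definition chi :: "complex \<Rightarrow> nat \<Rightarrow> complex" where
  "chi z i = chi1 z i + chi2_star z i"

definition chi_star :: "complex \<Rightarrow> nat \<Rightarrow> complex" where
  "chi_star z i = chi1_star z i + chi2 z i"

definition cmv_moment :: "(complex set \<Rightarrow> complex) \<Rightarrow> imat" where
  "cmv_moment \<mu> = (\<lambda>i j. circle_integral \<mu> (\<lambda>u. chi u i * cnj (chi u j)))"

definition gauss_borel :: "imat \<Rightarrow> imat \<Rightarrow> imat \<Rightarrow> bool" where
  "gauss_borel g S1 S2 \<longleftrightarrow>
     lower_unitriangular S1 \<and> upper_triangular_imat S2 \<and> g = imat_mult (imat_inv S1) S2"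

text \<open>For quasi-definite \<open>\<mu>\<close> the factorization exists and is unique.\<close>

definition cmv_S1 :: "(complex set \<Rightarrow> complex) \<Rightarrow> imat" where
  "cmv_S1 \<mu> = (THE S1. \<exists>S2. gauss_borel (cmv_moment \<mu>) S1 S2)"

definition cmv_S2 :: "(complex set \<Rightarrow> complex) \<Rightarrow> imat" where
  "cmv_S2 \<mu> = (THE S2. \<exists>S1. gauss_borel (cmv_moment \<mu>) S1 S2)"

definition cmv_phi1 :: "(complex set \<Rightarrow> complex) \<Rightarrow> nat \<Rightarrow> complex \<Rightarrow> complex" where
  "cmv_phi1 \<mu> l z = imat_vec (cmv_S1 \<mu>) (chi z) l"

definition cmv_phi2 :: "(complex set \<Rightarrow> complex) \<Rightarrow> nat \<Rightarrow> complex \<Rightarrow> complex" where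
  "cmv_phi2 \<mu> l z = imat_vec (imat_dagger (imat_inv (cmv_S2 \<mu>))) (chi z) l"

text \<open>Well defined, since a Laurent polynomial function determines its coefficients.\<close>

definition laurent_coeff :: "(complex \<Rightarrow> complex) \<Rightarrow> int \<Rightarrow> complex" where
  "laurent_coeff f = (THE a. finite {k. a k \<noteq> 0} \<and>
     (\<forall>z. z \<noteq> 0 \<longrightarrow> f z = (\<Sum>k | a k \<noteq> 0. a k * z powi k)))"

definition cmv_C11 :: "(complex set \<Rightarrow> complex) \<Rightarrow> nat \<Rightarrow> complex \<Rightarrow> complex" where
  "cmv_C11 \<mu> l z = imat_vec (imat_dagger (imat_inv (cmv_S1 \<mu>))) (chi1_star z) l"

definition cmv_C12 :: "(complex set \<Rightarrow> complex) \<Rightarrow> nat \<Rightarrow> complex \<Rightarrow> complex" where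
  "cmv_C12 \<mu> l z = imat_vec (imat_dagger (imat_inv (cmv_S1 \<mu>))) (chi2 z) l"

definition cmv_C21 :: "(complex set \<Rightarrow> complex) \<Rightarrow> nat \<Rightarrow> complex \<Rightarrow> complex" where
  "cmv_C21 \<mu> l z = imat_vec (cmv_S2 \<mu>) (chi1_star z) l"

definition cmv_C22 :: "(complex set \<Rightarrow> complex) \<Rightarrow> nat \<Rightarrow> complex \<Rightarrow> complex" where
  "cmv_C22 \<mu> l z = imat_vec (cmv_S2 \<mu>) (chi2 z) l"

definition cmv_C1 :: "(complex set \<Rightarrow> complex) \<Rightarrow> nat \<Rightarrow> complex \<Rightarrow> complex" where
  "cmv_C1 \<mu> l z = imat_vec (imat_dagger (imat_inv (cmv_S1 \<mu>))) (chi_star z) l"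

definition cmv_C2 :: "(complex set \<Rightarrow> complex) \<Rightarrow> nat \<Rightarrow> complex \<Rightarrow> complex" where
  "cmv_C2 \<mu> l z = imat_vec (cmv_S2 \<mu>) (chi_star z) l"

end

theory Submission
  imports Defs
begin

text \<open>
  The vector \<^const>\<open>chi\<close> lists the monomials \<open>z\<^sup>e\<close> with \<open>e = 0, -1, 1, -2, \<dots>\<close>; write \<open>e\<^sub>i\<close> for the
  \<open>i\<close>-th exponent. On the circle the conjugate of \<open>z\<close> is its inverse, so the moment matrix \<open>g\<close> has
  the entries \<open>2\<pi> c\<close> at \<open>e\<^sub>j - e\<^sub>i\<close>, that is, Fourier coefficients in a different order. Since
  \<open>S2 = S1 g\<close> and \<open>S1\<^sup>-\<^sup>1 = g S2\<^sup>-\<^sup>1\<close>, each row of \<open>S2\<close> and of the adjoint of \<open>S1\<^sup>-\<^sup>1\<close> is a finite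
  combination of rows of \<open>g\<close> and of its adjoint, and the weights are precisely the coefficients
  of \<open>\<phi>\<^sub>1\<close> and \<open>\<phi>\<^sub>2\<close> (\<open>cmv_S2_row\<close>, \<open>cmv_S1_inv_dagger_row\<close>).

  The entries of \<^const>\<open>chi_star\<close> are the monomials \<open>z\<close> to the power \<open>- 1 - e\<^sub>j\<close>. Hence a row of \<open>g\<close>
  or its adjoint times \<^const>\<open>chi_star\<close> is the Laurent series of the Fourier data times a monomial.
  Even indices \<open>j\<close> have \<open>e\<^sub>j \<ge> 0\<close> and odd ones \<open>e\<^sub>j < 0\<close>, so \<^const>\<open>chi1_star\<close> and \<^const>\<open>chi2\<close> cut this
  series into its two halves (\<open>chi1_star_sums\<close>, \<open>chi2_sums\<close>); up to finitely many terms, the halves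
  are a power series in \<open>z\<^sup>-\<^sup>1\<close> and one in \<open>z\<close>, and they converge absolutely in the stated regions by the root test. The
  formulas follow by interchanging the finite sum with the series (\<open>second_kind_functions\<close>).
  The two families need only one argument, because the reflection \<open>n \<mapsto> - n\<close> of the Fourier data
  exchanges \<open>z\<close> with \<open>z\<^sup>-\<^sup>1\<close> and the two halves of the series.

  What remains is to see that \<open>S1\<close>, \<open>S2\<close> and their inverses, which are given by definite
  descriptions, are the expected matrices. Quasi-definiteness makes every leading principal
  submatrix of \<open>g\<close> non-singular, as each is a Toeplitz matrix up to a simultaneous permutation of
  rows and columns (\<open>quasi_definite_sections_nonsingular\<close>). This determines the rows of \<open>S1\<close>
  uniquely and makes the diagonal of \<open>S2\<close> non-zero, so that forward substitution inverts both
  factors.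
\<close>

section \<open>Triangular matrices\<close>

definition lower_triangular_imat :: "imat \<Rightarrow> bool" where
  "lower_triangular_imat A \<longleftrightarrow> (\<forall>i j. i < j \<longrightarrow> A i j = 0)"

definition imat_transpose :: "imat \<Rightarrow> imat" where
  "imat_transpose A = (\<lambda>i j. A j i)"

lemma imat_mult_finite:
  assumes "finite K" "\<And>k. k \<notin> K \<Longrightarrow> A i k = 0 \<or> B k j = 0"
  shows "imat_mult A B i j = (\<Sum>k\<in>K. A i k * B k j)"
  unfolding imat_mult_def using assms by (intro suminf_finite) auto

lemma imat_mult_lower:
  assumes "lower_triangular_imat A" "i \<le> n"
  shows "imat_mult A B i j = (\<Sum>k\<le>n. A i k * B k j)"
  using assms by (intro imat_mult_finite) (auto simp: lower_triangular_imat_def)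

lemma imat_mult_upper:
  assumes "upper_triangular_imat B" "j \<le> n"
  shows "imat_mult A B i j = (\<Sum>k\<le>n. A i k * B k j)"
  using assms by (intro imat_mult_finite) (auto simp: upper_triangular_imat_def)

lemma imat_mult_transpose:
  "imat_mult (imat_transpose A) (imat_transpose B) = imat_transpose (imat_mult B A)"
  by (simp add: imat_mult_def imat_transpose_def mult.commute)

lemma imat_transpose_transpose [simp]: "imat_transpose (imat_transpose A) = A"
  by (simp add: imat_transpose_def)

lemma imat_transpose_one [simp]: "imat_transpose imat_one = imat_one"
  by (auto simp: imat_transpose_def imat_one_def fun_eq_iff)

lemma lower_triangular_transpose:
  "upper_triangular_imat A \<Longrightarrow> lower_triangular_imat (imat_transpose A)"
  by (simp add: lower_triangular_imat_def upper_triangular_imat_def imat_transpose_def)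

lemma upper_triangular_transpose:
  "lower_triangular_imat A \<Longrightarrow> upper_triangular_imat (imat_transpose A)"
  by (simp add: lower_triangular_imat_def upper_triangular_imat_def imat_transpose_def)

lemma lower_unitriangular_imp_lower_triangular:
  "lower_unitriangular A \<Longrightarrow> lower_triangular_imat A"
  by (simp add: lower_unitriangular_def lower_triangular_imat_def)

lemma lower_triangular_mult:
  assumes "lower_triangular_imat A" "lower_triangular_imat B"
  shows "lower_triangular_imat (imat_mult A B)"
  unfolding lower_triangular_imat_def
proof (intro allI impI)
  fix i j :: nat
  assume "i < j"
  then show "imat_mult A B i j = 0"
    unfolding imat_mult_lower[OF assms(1) order_refl]
    using assms(2) by (intro sum.neutral) (auto simp: lower_triangular_imat_def)
qed

lemma imat_mult_diag:
  assumes "lower_triangular_imat A" "lower_triangular_imat B"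
  shows "imat_mult A B i i = A i i * B i i"
proof -
  have "imat_mult A B i i = (\<Sum>k\<in>{i}. A i k * B k i)"
    using assms by (intro imat_mult_finite) (auto simp: lower_triangular_imat_def nat_neq_iff)
  then show ?thesis by simp
qed

lemma imat_mult_one_left: "imat_mult imat_one A = A"
proof (intro ext)
  fix i j
  have "imat_mult imat_one A i j = (\<Sum>k\<in>{i}. imat_one i k * A k j)"
    by (intro imat_mult_finite) (auto simp: imat_one_def)
  then show "imat_mult imat_one A i j = A i j" by (simp add: imat_one_def)
qed

lemma imat_mult_one_right: "imat_mult A imat_one = A"
proof (intro ext)
  fix i j
  have "imat_mult A imat_one i j = (\<Sum>k\<in>{j}. A i k * imat_one k j)"
    by (intro imat_mult_finite) (auto simp: imat_one_def)
  then show "imat_mult A imat_one i j = A i j" by (simp add: imat_one_def)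
qed

text \<open>
  Products of infinite matrices are not associative in general. The two cases below only involve
  finite sums, so that the order of summation may be exchanged.
\<close>

lemma imat_mult_assoc_lower:
  assumes A: "lower_triangular_imat A" and B: "lower_triangular_imat B"
  shows "imat_mult (imat_mult A B) C = imat_mult A (imat_mult B C)"
proof (intro ext)
  fix i j
  have "imat_mult (imat_mult A B) C i j = (\<Sum>k\<le>i. (\<Sum>m\<le>i. A i m * B m k) * C k j)"
    by (simp add: imat_mult_lower[OF lower_triangular_mult[OF A B] order_refl]
        imat_mult_lower[OF A order_refl])
  also have "\<dots> = (\<Sum>m\<le>i. A i m * (\<Sum>k\<le>i. B m k * C k j))"
    by (simp add: sum_distrib_left sum_distrib_right mult.assoc) (rule sum.swap)
  also have "\<dots> = (\<Sum>m\<le>i. A i m * imat_mult B C m j)"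
    by (intro sum.cong refl arg_cong2[where f = "(*)"] imat_mult_lower[OF B, symmetric]) auto
  also have "\<dots> = imat_mult A (imat_mult B C) i j"
    by (rule imat_mult_lower[OF A order_refl, symmetric])
  finally show "imat_mult (imat_mult A B) C i j = imat_mult A (imat_mult B C) i j" .
qed

lemma imat_mult_assoc_lower_upper:
  assumes A: "lower_triangular_imat A" and C: "upper_triangular_imat C"
  shows "imat_mult (imat_mult A B) C = imat_mult A (imat_mult B C)"
proof (intro ext)
  fix i j
  have "imat_mult (imat_mult A B) C i j = (\<Sum>k\<le>j. (\<Sum>m\<le>i. A i m * B m k) * C k j)"
    by (simp add: imat_mult_upper[OF C order_refl] imat_mult_lower[OF A order_refl])
  also have "\<dots> = (\<Sum>m\<le>i. A i m * (\<Sum>k\<le>j. B m k * C k j))"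
    by (simp add: sum_distrib_left sum_distrib_right mult.assoc) (rule sum.swap)
  also have "\<dots> = imat_mult A (imat_mult B C) i j"
    by (simp add: imat_mult_upper[OF C order_refl] imat_mult_lower[OF A order_refl])
  finally show "imat_mult (imat_mult A B) C i j = imat_mult A (imat_mult B C) i j" .
qed

fun forward_substitution :: "imat \<Rightarrow> (nat \<Rightarrow> complex) \<Rightarrow> nat \<Rightarrow> complex" where
  "forward_substitution L b i = (b i - (\<Sum>k<i. L i k * forward_substitution L b k)) / L i i"

declare forward_substitution.simps [simp del]

lemma lower_triangular_right_inverse:
  assumes L: "lower_triangular_imat L" and diag: "\<And>i. L i i \<noteq> 0"
  obtains X where "lower_triangular_imat X" "imat_mult L X = imat_one"
proof -
  define X where "X = (\<lambda>i j. forward_substitution L (\<lambda>i. imat_one i j) i)"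
  have "X i j = 0" if "i < j" for i j
    using that
  proof (induction i rule: less_induct)
    case (less i)
    have "(\<Sum>k<i. L i k * forward_substitution L (\<lambda>i. imat_one i j) k) = 0"
      using less by (intro sum.neutral) (simp add: X_def)
    then show ?case
      using less.prems unfolding X_def
      by (subst forward_substitution.simps) (simp add: imat_one_def)
  qed
  then have "lower_triangular_imat X" by (simp add: lower_triangular_imat_def)
  moreover have "imat_mult L X i j = imat_one i j" for i j
  proof -
    have "imat_mult L X i j = (\<Sum>k<i. L i k * X k j) + L i i * X i j"
      by (simp add: imat_mult_lower[OF L order_refl] flip: lessThan_Suc_atMost)
    also have "X i j = (imat_one i j - (\<Sum>k<i. L i k * X k j)) / L i i"
      unfolding X_def by (subst forward_substitution.simps) simp
    finally show ?thesis using diag by simp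
  qed
  ultimately show ?thesis using that by blast
qed

text \<open>
  The right inverse \<open>X\<close> has itself a right inverse \<open>X'\<close>, and associativity gives \<open>X' = L\<close>; hence
  \<open>X\<close> is a two-sided inverse. An arbitrary right inverse coincides with it after multiplication by
  \<open>X\<close> from the left, where only finite sums occur.
\<close>

lemma imat_inv_lower:
  assumes L: "lower_triangular_imat L" and diag: "\<And>i. L i i \<noteq> 0"
  shows "lower_triangular_imat (imat_inv L) \<and> imat_mult L (imat_inv L) = imat_one \<and>
    imat_mult (imat_inv L) L = imat_one"
proof -
  obtain X where X: "lower_triangular_imat X" "imat_mult L X = imat_one"
    using lower_triangular_right_inverse[OF L diag] .
  have "X i i \<noteq> 0" for i
    using imat_mult_diag[OF L X(1), of i] X(2) by (auto simp: imat_one_def)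
  then obtain X' where X': "lower_triangular_imat X'" "imat_mult X X' = imat_one"
    using lower_triangular_right_inverse[OF X(1)] by blast
  have "X' = imat_mult (imat_mult L X) X'" by (simp add: X imat_mult_one_left)
  also have "\<dots> = L" by (simp add: imat_mult_assoc_lower[OF L X(1)] X' imat_mult_one_right)
  finally have XL: "imat_mult X L = imat_one" using X' by simp
  have "imat_inv L = X" unfolding imat_inv_def
  proof (rule the_equality)
    show "imat_mult L X = imat_one \<and> imat_mult X L = imat_one" using X XL by simp
    fix B assume "imat_mult L B = imat_one \<and> imat_mult B L = imat_one"
    then have "imat_mult X (imat_mult L B) = X" by (simp add: imat_mult_one_right)
    then show "B = X"
      by (simp flip: imat_mult_assoc_lower[OF X(1) L] add: XL imat_mult_one_left)
  qed
  then show ?thesis using X XL by simp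
qed


text \<open>
  Transposition reduces this to the previous lemma. It carries the uniqueness of the inverse along,
  so that the two definite descriptions correspond.
\<close>

lemma imat_inv_upper:
  assumes U: "upper_triangular_imat U" and diag: "\<And>i. U i i \<noteq> 0"
  shows "upper_triangular_imat (imat_inv U) \<and> imat_mult U (imat_inv U) = imat_one"
proof -
  define L where "L = imat_transpose U"
  have L: "lower_triangular_imat L" "\<And>i. L i i \<noteq> 0"
    using lower_triangular_transpose[OF U] diag by (auto simp: L_def imat_transpose_def)
  have inv_iff: "imat_mult U B = imat_one \<and> imat_mult B U = imat_one \<longleftrightarrow>
      imat_mult L (imat_transpose B) = imat_one \<and> imat_mult (imat_transpose B) L = imat_one" for B
    by (metis L_def imat_mult_transpose imat_transpose_one imat_transpose_transpose)
  note invL = imat_inv_lower[OF L]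
  have "imat_inv U = imat_transpose (imat_inv L)" unfolding imat_inv_def[of U]
  proof (rule the_equality)
    show "imat_mult U (imat_transpose (imat_inv L)) = imat_one \<and>
        imat_mult (imat_transpose (imat_inv L)) U = imat_one"
      unfolding inv_iff using invL by simp
    fix B assume "imat_mult U B = imat_one \<and> imat_mult B U = imat_one"
    then have "imat_mult L (imat_transpose B) = imat_one" unfolding inv_iff by simp
    then have "imat_mult (imat_inv L) (imat_mult L (imat_transpose B)) = imat_inv L"
      by (simp add: imat_mult_one_right)
    then have "imat_transpose B = imat_inv L"
      using invL by (simp flip: imat_mult_assoc_lower add: L imat_mult_one_left)
    then show "B = imat_transpose (imat_inv L)"
      by (metis imat_transpose_transpose)
  qed
  moreover have "imat_mult U (imat_transpose (imat_inv L)) = imat_one"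
    using inv_iff[of "imat_transpose (imat_inv L)"] invL by simp
  ultimately show ?thesis using upper_triangular_transpose invL by simp
qed

section \<open>The Gauss--Borel factorization\<close>

text \<open>
  The sections are the leading principal submatrices. Their non-singularity is expressed by the
  left kernel, because a row of \<open>S1\<close> acts on \<open>g\<close> from the left and because this form is invariant
  under permutations of the index range.
\<close>

definition sections_nonsingular :: "imat \<Rightarrow> bool" where
  "sections_nonsingular g \<longleftrightarrow>
     (\<forall>n v. (\<forall>j<n. (\<Sum>i<n. v i * g i j) = 0) \<longrightarrow> (\<forall>i<n. v i = 0))"

lemma sections_nonsingularD:
  assumes "sections_nonsingular g" "\<And>j. j < n \<Longrightarrow> (\<Sum>i<n. v i * g i j) = 0" "i < n"
  shows "v i = 0"
  using assms unfolding sections_nonsingular_def by blast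

lemma det_nonzero_imp_left_kernel_trivial:
  fixes A :: imat
  assumes det: "Determinant.det (Matrix.mat n n (\<lambda>(i, j). A i j)) \<noteq> 0"
    and ker: "\<And>j. j < n \<Longrightarrow> (\<Sum>i<n. v i * A i j) = 0" and "i < n"
  shows "v i = 0"
proof -
  define M where "M = Matrix.mat n n (\<lambda>(i, j). A j i)"
  have M: "M \<in> carrier_mat n n" by (simp add: M_def)
  have "M = transpose_mat (Matrix.mat n n (\<lambda>(i, j). A i j))"
    by (rule eq_matI) (auto simp: M_def)
  then have "Determinant.det M \<noteq> 0"
    using det by (simp add: Determinant.det_transpose[of _ n])
  moreover have "Matrix.vec n v \<in> carrier_vec n" by simp
  moreover have "M *\<^sub>v Matrix.vec n v = 0\<^sub>v n"
    by (rule eq_vecI)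
      (auto simp: M_def scalar_prod_def row_def ker lessThan_atLeast0 [symmetric] mult.commute)
  ultimately have "Matrix.vec n v = 0\<^sub>v n"
    using det_0_iff_vec_prod_zero[OF M] by blast
  then have "vec_index (Matrix.vec n v) i = vec_index (0\<^sub>v n) i" by simp
  then show ?thesis using \<open>i < n\<close> by simp
qed

lemma left_kernel_trivial_imp_solvable:
  fixes A :: imat
  assumes ker: "\<And>v i. \<lbrakk>\<And>j. j < n \<Longrightarrow> (\<Sum>i<n. v i * A i j) = 0; i < n\<rbrakk> \<Longrightarrow> v i = 0"
  obtains x where "\<And>j. j < n \<Longrightarrow> (\<Sum>i<n. x i * A i j) = b j"
proof -
  define M where "M = Matrix.mat n n (\<lambda>(i, j). A j i)"
  have M: "M \<in> carrier_mat n n" by (simp add: M_def)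
  have mult: "vec_index (M *\<^sub>v v) j = (\<Sum>i<n. vec_index v i * A i j)"
    if "v \<in> carrier_vec n" "j < n" for v j
    using that by (auto simp: M_def scalar_prod_def row_def lessThan_atLeast0 mult.commute
        intro!: sum.cong)
  have "v = 0\<^sub>v n" if v: "v \<in> carrier_vec n" "M *\<^sub>v v = 0\<^sub>v n" for v
  proof (rule eq_vecI)
    fix i assume i: "i < dim_vec (0\<^sub>v n :: complex Matrix.vec)"
    have "(\<Sum>i<n. vec_index v i * A i j) = 0" if "j < n" for j
      using mult[OF v(1) that] v(2) that by simp
    then show "vec_index v i = vec_index (0\<^sub>v n) i" using ker[of "vec_index v" i] i by simp
  qed (use v in auto)
  then have "Determinant.det M \<noteq> 0"
    using det_0_iff_vec_prod_zero[OF M] by blast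
  from det_non_zero_imp_unit[OF M this, of "()"]
  obtain B where B: "B \<in> carrier_mat n n" "M * B = 1\<^sub>m n"
    unfolding Units_def ring_mat_def by auto
  define x where "x = B *\<^sub>v Matrix.vec n b"
  have x: "x \<in> carrier_vec n" using B by (simp add: x_def)
  have "M *\<^sub>v x = (M * B) *\<^sub>v Matrix.vec n b"
    unfolding x_def by (rule assoc_mult_mat_vec[OF M B(1), symmetric]) simp
  then have "M *\<^sub>v x = Matrix.vec n b" by (simp add: B)
  then have "(\<Sum>i<n. vec_index x i * A i j) = b j" if "j < n" for j
    using mult[OF x that] that by simp
  then show ?thesis by (rule that)
qed

text \<open>
  Multiplying by the inverse of \<open>S1\<close>, which is lower triangular, turns the factorization into
  linear equations for the rows of \<open>S1\<close>.
\<close>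

lemma gauss_borel_iff:
  "gauss_borel g S1 S2 \<longleftrightarrow>
     lower_unitriangular S1 \<and> upper_triangular_imat S2 \<and> S2 = imat_mult S1 g"
proof (cases "lower_unitriangular S1")
  case True
  then have L: "lower_triangular_imat S1" by (rule lower_unitriangular_imp_lower_triangular)
  have "S1 i i \<noteq> 0" for i using True by (simp add: lower_unitriangular_def)
  note inv = imat_inv_lower[OF L this]
  have "g = imat_mult (imat_inv S1) S2 \<longleftrightarrow> S2 = imat_mult S1 g"
    using inv L imat_mult_assoc_lower imat_mult_one_left by metis
  then show ?thesis using True by (simp add: gauss_borel_def)
qed (simp add: gauss_borel_def)

text \<open>
  Row \<open>l\<close> of \<open>S1 g\<close> must vanish to the left of the diagonal. As \<open>S1\<close> ends with the entry 1 in this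
  row, its other \<open>l\<close> entries solve a linear system whose matrix is the section of size \<open>l\<close>, and so
  there is exactly one solution.
\<close>

lemma gauss_borel_unique:
  assumes g: "sections_nonsingular g" and "gauss_borel g S1 S2" "gauss_borel g T1 T2"
  shows "S1 = T1" "S2 = T2"
proof -
  have S: "lower_unitriangular S1" "upper_triangular_imat (imat_mult S1 g)" "S2 = imat_mult S1 g"
    and T: "lower_unitriangular T1" "upper_triangular_imat (imat_mult T1 g)" "T2 = imat_mult T1 g"
    using assms by (auto simp: gauss_borel_iff)
  have row: "(\<Sum>i<l. R l i * g i j) = - g l j"
    if "lower_unitriangular R" "upper_triangular_imat (imat_mult R g)" "j < l" for R l j
  proof -
    have "0 = imat_mult R g l j" using that by (simp add: upper_triangular_imat_def)
    also have "\<dots> = (\<Sum>i\<le>l. R l i * g i j)"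
      using that by (intro imat_mult_lower lower_unitriangular_imp_lower_triangular) auto
    also have "\<dots> = (\<Sum>i<l. R l i * g i j) + g l j"
      using that(1) by (simp add: lower_unitriangular_def flip: lessThan_Suc_atMost)
    finally show ?thesis by (simp add: eq_neg_iff_add_eq_0)
  qed
  show "S1 = T1"
  proof (intro ext)
    fix l i :: nat
    consider "i < l" | "i = l" | "l < i" by linarith
    then show "S1 l i = T1 l i"
    proof cases
      case 1
      have "(\<Sum>i<l. (S1 l i - T1 l i) * g i j) = 0" if "j < l" for j
        using row[OF S(1,2) that] row[OF T(1,2) that]
        by (simp add: left_diff_distrib sum_subtractf)
      from sections_nonsingularD[OF g this 1] show ?thesis by simp
    qed (use S T in \<open>auto simp: lower_unitriangular_def\<close>)
  qed
  then show "S2 = T2" using S T by simp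
qed

lemma gauss_borel_exists:
  assumes g: "sections_nonsingular g"
  shows "\<exists>S1 S2. gauss_borel g S1 S2"
proof -
  have "\<exists>x. \<forall>j<l. (\<Sum>i<l. x i * g i j) = - g l j" for l
  proof -
    obtain x where "\<And>j. j < l \<Longrightarrow> (\<Sum>i<l. x i * g i j) = - g l j"
      using left_kernel_trivial_imp_solvable[of l g "\<lambda>j. - g l j"] sections_nonsingularD[OF g]
      by blast
    then show ?thesis by blast
  qed
  then obtain x where x: "\<And>l j. j < l \<Longrightarrow> (\<Sum>i<l. x l i * g i j) = - g l j" by metis
  define S1 :: imat where "S1 = (\<lambda>l i. if i < l then x l i else if i = l then 1 else 0)"
  have S1: "lower_unitriangular S1" by (simp add: S1_def lower_unitriangular_def)
  have "upper_triangular_imat (imat_mult S1 g)"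
    unfolding upper_triangular_imat_def
  proof (intro allI impI)
    fix l j :: nat assume "j < l"
    have "imat_mult S1 g l j = (\<Sum>i<l. S1 l i * g i j) + S1 l l * g l j"
      by (simp add: imat_mult_lower[OF lower_unitriangular_imp_lower_triangular[OF S1] order_refl]
          flip: lessThan_Suc_atMost)
    also have "(\<Sum>i<l. S1 l i * g i j) = (\<Sum>i<l. x l i * g i j)"
      by (simp add: S1_def)
    finally show "imat_mult S1 g l j = 0" using x[OF \<open>j < l\<close>] by (simp add: S1_def)
  qed
  then show ?thesis using S1 gauss_borel_iff by blast
qed

text \<open>
  A zero in position \<open>l\<close> of the diagonal would make row \<open>l\<close> of \<open>S1\<close>, which ends in the entry 1,
  annihilate the section of size \<open>l + 1\<close>.
\<close>

lemma gauss_borel_diag_nonzero: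
  assumes g: "sections_nonsingular g" and S: "gauss_borel g S1 S2"
  shows "S2 l l \<noteq> 0"
proof
  assume zero: "S2 l l = 0"
  have L: "lower_unitriangular S1" "upper_triangular_imat S2" and S2: "S2 = imat_mult S1 g"
    using S by (auto simp: gauss_borel_iff)
  have "(\<Sum>i<Suc l. S1 l i * g i j) = 0" if "j < Suc l" for j
  proof -
    have "(\<Sum>i<Suc l. S1 l i * g i j) = S2 l j"
      using imat_mult_lower[OF lower_unitriangular_imp_lower_triangular[OF L(1)] order_refl]
      by (simp add: S2 lessThan_Suc_atMost)
    also have "\<dots> = 0"
      using zero L(2) that by (cases "j = l") (auto simp: upper_triangular_imat_def)
    finally show ?thesis .
  qed
  from sections_nonsingularD[OF g this, of l] show False
    using L(1) by (simp add: lower_unitriangular_def)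
qed

text \<open>
  Multiplying \<open>g = S1\<^sup>-\<^sup>1 S2\<close> by \<open>S2\<^sup>-\<^sup>1\<close> from the right removes the factor \<open>S2\<close>.
\<close>

lemma gauss_borel_inverse:
  assumes g: "sections_nonsingular g" and S: "gauss_borel g S1 S2"
  shows "upper_triangular_imat (imat_inv S2)" "imat_inv S1 = imat_mult g (imat_inv S2)"
proof -
  have L: "lower_unitriangular S1" "upper_triangular_imat S2"
    and fact: "g = imat_mult (imat_inv S1) S2"
    using S by (auto simp: gauss_borel_def)
  have "S1 i i \<noteq> 0" for i using L(1) by (simp add: lower_unitriangular_def)
  note inv1 = imat_inv_lower[OF lower_unitriangular_imp_lower_triangular[OF L(1)] this]
  note inv2 = imat_inv_upper[OF L(2) gauss_borel_diag_nonzero[OF g S]]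
  show "upper_triangular_imat (imat_inv S2)" using inv2 by simp
  have "imat_mult g (imat_inv S2) = imat_mult (imat_inv S1) (imat_mult S2 (imat_inv S2))"
    unfolding fact using inv1 inv2 by (intro imat_mult_assoc_lower_upper) auto
  then show "imat_inv S1 = imat_mult g (imat_inv S2)" using inv2 by (simp add: imat_mult_one_right)
qed

section \<open>The CMV ordering of the moments\<close>

text \<open>The exponents \<open>0, -1, 1, -2, 2, \<dots>\<close> of the monomials in \<^const>\<open>chi\<close>.\<close>

definition cmv_exp :: "nat \<Rightarrow> int" where
  "cmv_exp i = (if even i then int (i div 2) else - int (i div 2) - 1)"

definition cmv_index :: "int \<Rightarrow> nat" where
  "cmv_index k = (if k \<ge> 0 then 2 * nat k else 2 * nat (- k - 1) + 1)"

lemma cmv_index_exp [simp]: "cmv_index (cmv_exp i) = i"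
  by (auto simp: cmv_index_def cmv_exp_def nat_diff_distrib' elim: evenE oddE)

lemma cmv_exp_index [simp]: "cmv_exp (cmv_index k) = k"
  by (auto simp: cmv_index_def cmv_exp_def)

lemma inj_cmv_exp: "inj_on cmv_exp A"
  by (metis cmv_index_exp inj_onI)

lemma powi_neg_int_minus_one: "(z :: complex) powi (- int m - 1) = inverse z * inverse z ^ m"
proof -
  have "- int m - 1 = - int (Suc m)" by simp
  then show ?thesis by (simp only: power_int_minus power_int_of_nat) (simp add: power_inverse)
qed

lemma chi_eq_powi: "chi z i = z powi cmv_exp i"
  by (simp add: chi_def chi1_def chi2_star_def chi2_def cmv_exp_def powi_neg_int_minus_one)

lemma chi1_star_eq_powi: "chi1_star z j = (if even j then z powi (- 1 - cmv_exp j) else 0)"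
proof -
  have "- 1 - int (j div 2) = - int (j div 2) - 1" by simp
  then have "z powi (- 1 - int (j div 2)) = inverse z * inverse z ^ (j div 2)"
    by (simp only: powi_neg_int_minus_one)
  then show ?thesis by (simp add: chi1_star_def chi1_def cmv_exp_def)
qed

lemma chi2_eq_powi: "chi2 z j = (if odd j then z powi (- 1 - cmv_exp j) else 0)"
  by (simp add: chi2_def cmv_exp_def)

lemma circle_integral_cong:
  assumes "\<And>u. cmod u = 1 \<Longrightarrow> f u = h u"
  shows "circle_integral \<mu> f = circle_integral \<mu> h"
proof -
  have "integral\<^sup>L (upper_variation circle_borel \<nu>) f =
      integral\<^sup>L (upper_variation circle_borel \<nu>) h" for \<nu>
    using assms
    by (intro Bochner_Integration.integral_cong)
      (auto simp: upper_variation_def circle_borel_def space_restrict_space space_measure_of_conv)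
  then show ?thesis
    by (simp add: circle_integral_def complex_integral_def signed_integral_def)
qed

lemma cnj_eq_inverse_on_circle: "cmod u = 1 \<Longrightarrow> cnj u = inverse u"
  using complex_norm_square[of u] inverse_unique[of u "cnj u"] by simp

lemma cmv_moment_eq:
  "cmv_moment \<mu> i j = circle_integral \<mu> (\<lambda>u. u powi (cmv_exp i - cmv_exp j))"
  unfolding cmv_moment_def
proof (rule circle_integral_cong)
  fix u :: complex assume u: "cmod u = 1"
  then have "u \<noteq> 0" by auto
  have "cnj (chi u j) = u powi (- cmv_exp j)"
    by (simp add: chi_eq_powi complex_cnj_power_int cnj_eq_inverse_on_circle u power_int_inverse
        power_int_minus)
  then show "chi u i * cnj (chi u j) = u powi (cmv_exp i - cmv_exp j)"
    using \<open>u \<noteq> 0\<close> by (simp add: chi_eq_powi power_int_diff power_int_minus divide_inverse)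
qed

lemma cmv_moment_eq_fourier_coeff:
  "cmv_moment \<mu> i j = 2 * pi * fourier_coeff \<mu> (cmv_exp j - cmv_exp i)"
  by (simp add: cmv_moment_eq fourier_coeff_def)

text \<open>
  The exponents of the first \<open>n\<close> monomials are \<open>n\<close> consecutive integers, the smallest of which is
  \<open>- (n div 2)\<close>. So the section of size \<open>n\<close> of the moment matrix arises from the Toeplitz matrix of
  the same size by applying one permutation to the rows and to the columns.
\<close>

lemma bij_betw_cmv_exp_shift: "bij_betw (\<lambda>i. nat (cmv_exp i + int (n div 2))) {..<n} {..<n}"
proof -
  have nonneg: "0 \<le> cmv_exp i + int (n div 2)" "cmv_exp i + int (n div 2) < int n" if "i < n" for i
    using that by (auto simp: cmv_exp_def elim!: evenE oddE)
  have "inj_on (\<lambda>i. nat (cmv_exp i + int (n div 2))) {..<n}"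
  proof (rule inj_onI)
    fix i j
    assume ij: "i \<in> {..<n}" "j \<in> {..<n}"
      and eq: "nat (cmv_exp i + int (n div 2)) = nat (cmv_exp j + int (n div 2))"
    have "cmv_exp i = cmv_exp j" using eq nonneg(1)[of i] nonneg(1)[of j] ij by simp
    then show "i = j" by (metis cmv_index_exp)
  qed
  moreover have "(\<lambda>i. nat (cmv_exp i + int (n div 2))) ` {..<n} \<subseteq> {..<n}"
    using nonneg by (auto simp: nat_less_iff)
  ultimately show ?thesis
    by (simp add: bij_betw_def endo_inj_surj)
qed

lemma quasi_definite_sections_nonsingular:
  assumes "quasi_definite \<mu>"
  shows "sections_nonsingular (cmv_moment \<mu>)"
  unfolding sections_nonsingular_def
proof (intro allI impI)
  fix n v i
  assume ker: "\<forall>j<n. (\<Sum>i<n. v i * cmv_moment \<mu> i j) = 0" and i: "i < n"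
  define T :: imat where "T = (\<lambda>i j. circle_integral \<mu> (\<lambda>u. u powi (int i - int j)))"
  define s where "s = (\<lambda>i. nat (cmv_exp i + int (n div 2)))"
  \<comment> \<open>The row vector that corresponds to \<open>v\<close> after the permutation \<open>s\<close>.\<close>
  define w where "w = (\<lambda>a. v (inv_into {..<n} s a))"
  have s: "bij_betw s {..<n} {..<n}"
    unfolding s_def by (rule bij_betw_cmv_exp_shift)
  have w: "w (s i) = v i" if "i < n" for i
    using that s by (simp add: w_def bij_betw_inv_into_left)
  have int_s: "int (s i) = cmv_exp i + int (n div 2)" if "i < n" for i
    using that by (auto simp: s_def cmv_exp_def elim!: evenE oddE)
  have "Determinant.det (Matrix.mat n n (\<lambda>(i, j). T i j)) \<noteq> 0"
    using assms i by (cases n) (auto simp: quasi_definite_def toeplitz_def T_def)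
  moreover have "(\<Sum>a<n. w a * T a b) = 0" if b: "b < n" for b
  proof -
    obtain j where j: "j < n" "b = s j" using s b by (auto simp: bij_betw_def)
    have "(\<Sum>a<n. w a * T a b) = (\<Sum>i<n. w (s i) * T (s i) b)"
      by (rule sum.reindex_bij_betw[OF s, symmetric])
    also have "\<dots> = (\<Sum>i<n. v i * cmv_moment \<mu> i j)"
      using j by (intro sum.cong refl) (simp add: w T_def int_s cmv_moment_eq)
    finally show ?thesis using ker j by simp
  qed
  moreover have "s i < n" using s i by (auto simp: bij_betw_def)
  ultimately have "w (s i) = 0" by (rule det_nonzero_imp_left_kernel_trivial)
  then show "v i = 0" using w i by simp
qed

lemma gauss_borel_cmv:
  assumes "sections_nonsingular (cmv_moment \<mu>)"
  shows "gauss_borel (cmv_moment \<mu>) (cmv_S1 \<mu>) (cmv_S2 \<mu>)"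
proof -
  obtain S1 S2 where S: "gauss_borel (cmv_moment \<mu>) S1 S2"
    using gauss_borel_exists[OF assms] by blast
  have "cmv_S1 \<mu> = S1" "cmv_S2 \<mu> = S2"
    unfolding cmv_S1_def cmv_S2_def using gauss_borel_unique[OF assms] S by blast+
  then show ?thesis using S by simp
qed

lemma cmv_S2_row:
  assumes "quasi_definite \<mu>"
  shows "cmv_S2 \<mu> l j =
    2 * pi * (\<Sum>i\<le>l. cmv_S1 \<mu> l i * fourier_coeff \<mu> (cmv_exp j - cmv_exp i))"
proof -
  have L: "lower_unitriangular (cmv_S1 \<mu>)" and "cmv_S2 \<mu> = imat_mult (cmv_S1 \<mu>) (cmv_moment \<mu>)"
    using gauss_borel_cmv[OF quasi_definite_sections_nonsingular[OF assms]]
    by (auto simp: gauss_borel_iff)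
  then show ?thesis
    by (simp add: imat_mult_lower[OF lower_unitriangular_imp_lower_triangular[OF L] order_refl]
        cmv_moment_eq_fourier_coeff sum_distrib_left mult_ac)
qed

lemma cmv_S1_inv_dagger_row:
  assumes "quasi_definite \<mu>"
  shows "imat_dagger (imat_inv (cmv_S1 \<mu>)) l j =
    2 * pi * (\<Sum>i\<le>l. imat_dagger (imat_inv (cmv_S2 \<mu>)) l i *
      conj_coeffs (fourier_coeff \<mu>) (cmv_exp i - cmv_exp j))"
proof -
  note g = quasi_definite_sections_nonsingular[OF assms]
  note inv = gauss_borel_inverse[OF g gauss_borel_cmv[OF g]]
  show ?thesis
    by (simp add: imat_dagger_def inv(2) imat_mult_upper[OF inv(1) order_refl]
        cmv_moment_eq_fourier_coeff conj_coeffs_def sum_distrib_left mult_ac)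
qed

section \<open>Laurent polynomials\<close>

text \<open>
  Multiplication by a power of \<open>z\<close> reduces this to the identity theorem for polynomials.
\<close>

lemma laurent_polynomial_eq_0_imp_coeff_eq_0:
  fixes d :: "int \<Rightarrow> complex"
  assumes K: "finite K" and zero: "\<And>z. z \<noteq> 0 \<Longrightarrow> (\<Sum>k\<in>K. d k * z powi k) = 0"
    and k: "k \<in> K"
  shows "d k = 0"
proof -
  obtain N where N: "\<And>k. k \<in> K \<Longrightarrow> - N \<le> k"
    using K by (metis bdd_below_finite bdd_below.unfold minus_minus)
  define p where "p = (\<Sum>k\<in>K. monom (d k) (nat (k + N)))"
  have "poly p z = 0" if z: "z \<noteq> 0" for z
  proof -
    have "poly p z = (\<Sum>k\<in>K. d k * z powi (k + N))"
      using N by (force simp: p_def poly_sum poly_monom power_int_def intro!: sum.cong)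
    also have "\<dots> = (\<Sum>k\<in>K. d k * z powi k) * z powi N"
      using z by (simp add: power_int_add sum_distrib_right mult.assoc)
    finally show ?thesis using zero[OF z] by simp
  qed
  \<comment> \<open>The additional factor \<open>z\<close> takes care of the point 0, where \<open>p\<close> is not known to vanish.\<close>
  then have "poly (pCons 0 p) z = 0" for z by auto
  then have "p = 0" by (metis pCons_eq_0_iff poly_all_0_iff_0)
  then have "0 = coeff p (nat (k + N))" by simp
  also have "\<dots> = (\<Sum>m\<in>K. if m = k then d m else 0)"
    unfolding p_def coeff_sum coeff_monom
  proof (intro sum.cong refl)
    fix m assume "m \<in> K"
    then have "0 \<le> m + N" "0 \<le> k + N" using N[of m] N[OF k] by simp_all
    then show "(if nat (m + N) = nat (k + N) then d m else 0) = (if m = k then d m else 0)"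
      by (simp add: eq_nat_nat_iff)
  qed
  also have "\<dots> = d k" using K k by simp
  finally show ?thesis by simp
qed

lemma laurent_coeff_eqI:
  assumes fin: "finite {k. a k \<noteq> 0}"
    and f: "\<And>z. z \<noteq> 0 \<Longrightarrow> f z = (\<Sum>k | a k \<noteq> 0. a k * z powi k)"
  shows "laurent_coeff f = a"
  unfolding laurent_coeff_def
proof (rule the_equality)
  show "finite {k. a k \<noteq> 0} \<and> (\<forall>z. z \<noteq> 0 \<longrightarrow> f z = (\<Sum>k | a k \<noteq> 0. a k * z powi k))"
    using assms by simp
  fix b assume b: "finite {k. b k \<noteq> 0} \<and>
    (\<forall>z. z \<noteq> 0 \<longrightarrow> f z = (\<Sum>k | b k \<noteq> 0. b k * z powi k))"
  define K where "K = {k. a k \<noteq> 0} \<union> {k. b k \<noteq> 0}"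
  have K: "finite K" using fin b by (simp add: K_def)
  have extend: "(\<Sum>k | h k \<noteq> 0. h k * z powi k) = (\<Sum>k\<in>K. h k * z powi k)"
    if "{k. h k \<noteq> 0} \<subseteq> K" for h :: "int \<Rightarrow> complex" and z
    using K that by (intro sum.mono_neutral_left) auto
  have "(\<Sum>k\<in>K. (b k - a k) * z powi k) = 0" if z: "z \<noteq> 0" for z
  proof -
    have "(\<Sum>k\<in>K. b k * z powi k) = f z" "(\<Sum>k\<in>K. a k * z powi k) = f z"
      using extend[of a z] extend[of b z] f[OF z] b z by (auto simp: K_def)
    then show ?thesis by (simp add: left_diff_distrib sum_subtractf)
  qed
  from laurent_polynomial_eq_0_imp_coeff_eq_0[OF K this]
  have "b k - a k = 0" if "k \<in> K" for k using that by blast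
  then show "b = a" by (force simp: K_def)
qed

lemma lower_triangular_imat_vec_chi:
  assumes "lower_triangular_imat A"
  shows "imat_vec A (chi z) l = (\<Sum>i\<le>l. A l i * z powi cmv_exp i)"
  unfolding imat_vec_def chi_eq_powi
  using assms by (intro suminf_finite) (auto simp: lower_triangular_imat_def)

text \<open>
  A sum over the exponents that occur in a CMV Laurent polynomial is a sum over a matrix row: the
  coefficient of \<open>z powi k\<close> is the row entry at \<open>cmv_index k\<close>.
\<close>

lemma sum_laurent_coeff_imat_vec_chi:
  fixes l :: nat
  assumes A: "lower_triangular_imat A"
  defines "a \<equiv> laurent_coeff (\<lambda>z. imat_vec A (chi z) l)"
  shows "(\<Sum>k | a k \<noteq> 0. a k * G k) = (\<Sum>i\<le>l. A l i * G (cmv_exp i))"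
proof -
  define b where "b = (\<lambda>k. A l (cmv_index k))"
  have sub: "{k. b k \<noteq> 0} \<subseteq> cmv_exp ` {..l}"
  proof
    fix k assume "k \<in> {k. b k \<noteq> 0}"
    then have "cmv_index k \<le> l"
      using A by (force simp: b_def lower_triangular_imat_def not_less[symmetric])
    then show "k \<in> cmv_exp ` {..l}" by (metis atMost_iff cmv_exp_index image_eqI)
  qed
  have sum: "(\<Sum>k | b k \<noteq> 0. b k * H k) = (\<Sum>i\<le>l. A l i * H (cmv_exp i))" for H
  proof -
    have "(\<Sum>k | b k \<noteq> 0. b k * H k) = (\<Sum>k\<in>cmv_exp ` {..l}. b k * H k)"
      using sub by (intro sum.mono_neutral_left) auto
    also have "\<dots> = (\<Sum>i\<le>l. A l i * H (cmv_exp i))"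
      by (simp add: sum.reindex[OF inj_cmv_exp] b_def)
    finally show ?thesis .
  qed
  have "a = b" unfolding a_def
  proof (rule laurent_coeff_eqI)
    show "finite {k. b k \<noteq> 0}" using sub by (rule finite_subset) simp
  qed (simp add: sum lower_triangular_imat_vec_chi[OF A])
  then show ?thesis by (simp add: sum)
qed

section \<open>Laurent series in the annulus of convergence\<close>

lemma R_plus_eq_conv_radius: "R_plus d = conv_radius (\<lambda>n. d (int n))"
  by (simp add: R_plus_def conv_radius_def)

lemma R_minus_nonneg: "0 \<le> R_minus d"
  unfolding R_minus_def by (intro le_Limsup) (auto simp: real_root_ge_zero)

text \<open>
  The lower bound of the range does not affect convergence, because it changes finitely many terms
  of the power series.
\<close>

lemma summable_on_nonneg_part:
  assumes "ereal (cmod z) < R_plus d"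
  shows "(\<lambda>n. d n * z powi n) summable_on {n. n \<ge> m}"
proof -
  have "summable (\<lambda>n. norm (d (int n) * z ^ n))"
    using assms unfolding R_plus_eq_conv_radius by (rule abs_summable_in_conv_radius)
  then have "(\<lambda>n. d (int n) * z powi int n) summable_on UNIV"
    by (simp add: norm_summable_imp_summable_on)
  moreover have "bij_betw int UNIV {0..}"
    by (rule bij_betw_byWitness[where f' = nat]) auto
  ultimately have "(\<lambda>n. d n * z powi n) summable_on {0..}"
    using summable_on_reindex_bij_betw[of int UNIV "{0..}" "\<lambda>n. d n * z powi n"] by simp
  then have "(\<lambda>n. d n * z powi n) summable_on ({0..} \<union> {m..<0})"
    by (intro summable_on_union) auto
  then show ?thesis by (rule summable_on_subset_banach) auto
qed

text \<open>
  Reflecting the coefficients amounts to the substitution of \<open>inverse z\<close> for \<open>z\<close>, which exchanges the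
  two halves of a Laurent series and inverts the radii.
\<close>

lemma R_plus_reflect: "R_plus (\<lambda>n. d (- n)) = inverse (R_minus d)"
  by (simp add: R_plus_def R_minus_def)

lemma R_minus_reflect: "R_minus (\<lambda>n. d (- n)) = inverse (R_plus d)"
proof -
  have "inverse (inverse L) = L" if "0 \<le> L" for L :: ereal
    using that by (cases L) auto
  moreover have "0 \<le> R_minus (\<lambda>n. d (- n))" by (rule R_minus_nonneg)
  ultimately show ?thesis by (simp add: R_plus_def R_minus_def)
qed

lemma R_plus_conj_coeffs: "R_plus (conj_coeffs d) = R_plus d"
  and R_minus_conj_coeffs: "R_minus (conj_coeffs d) = R_minus d"
  by (simp_all add: R_plus_def R_minus_def conj_coeffs_def)

lemma R_minus_less_imp_nonzero: "R_minus d < ereal (cmod z) \<Longrightarrow> z \<noteq> 0"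
  using R_minus_nonneg[of d] by (auto simp flip: zero_ereal_def)

lemma bij_betw_uminus_int: "bij_betw uminus {n :: int. n < m} {n. n \<ge> 1 - m}"
  "bij_betw uminus {n :: int. n \<ge> m} {n. n < 1 - m}"
  by (rule bij_betw_byWitness[where f' = uminus]; auto)+

lemma powi_uminus_eq_inverse_powi: "(z :: complex) powi (- n) = inverse z powi n"
  by (simp add: power_int_inverse power_int_minus)

lemma summable_on_neg_part:
  assumes "R_minus d < ereal (cmod z)"
  shows "(\<lambda>n. d n * z powi n) summable_on {n. n < m}"
proof -
  have "inverse (ereal (cmod z)) < inverse (R_minus d)"
    using ereal_inverse_antimono_strict[OF R_minus_nonneg assms] .
  moreover have "inverse (ereal (cmod z)) = ereal (cmod (inverse z))"
    using R_minus_less_imp_nonzero[OF assms] by (simp add: norm_inverse)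
  ultimately have "ereal (cmod (inverse z)) < R_plus (\<lambda>n. d (- n))"
    by (simp add: R_plus_reflect)
  then have "(\<lambda>n. d (- n) * inverse z powi n) summable_on {n. n \<ge> 1 - m}"
    by (rule summable_on_nonneg_part)
  then have "(\<lambda>n. d (- n) * z powi (- n)) summable_on {n. n \<ge> 1 - m}"
    by (simp add: powi_uminus_eq_inverse_powi)
  then show ?thesis
    using summable_on_reindex_bij_betw[OF bij_betw_uminus_int(2)[of "1 - m"],
        of "\<lambda>n. d n * z powi n"] by simp
qed

lemma F_plus_reflect: "F_plus (\<lambda>n. d (- n)) (- k - 1) z = F_minus d k (inverse z)"
  using infsum_reindex_bij_betw[OF bij_betw_uminus_int(1)[of "- k"],
      of "\<lambda>n. d (- n) * z powi n"]
  by (simp add: F_plus_def F_minus_def powi_uminus_eq_inverse_powi add.commute)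

lemma F_minus_reflect: "F_minus (\<lambda>n. d (- n)) (- k - 1) z = F_plus d k (inverse z)"
  using infsum_reindex_bij_betw[OF bij_betw_uminus_int(2)[of "- k"],
      of "\<lambda>n. d (- n) * z powi n"]
  by (simp add: F_plus_def F_minus_def powi_uminus_eq_inverse_powi add.commute)

lemma bij_betw_uminus_int_UNIV: "bij_betw uminus (UNIV :: int set) UNIV"
  by (rule bij_betw_byWitness[where f' = uminus]) auto

lemma F_full_reflect: "F_full (\<lambda>n. d (- n)) z = F_full d (inverse z)"
  using infsum_reindex_bij_betw[OF bij_betw_uminus_int_UNIV, of "\<lambda>n. d (- n) * z powi n"]
  by (simp add: F_full_def powi_uminus_eq_inverse_powi)

lemma
  assumes "R_minus d < ereal (cmod z)" "ereal (cmod z) < R_plus d"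
  shows summable_on_annulus: "(\<lambda>n. d n * z powi n) summable_on UNIV"
    and F_minus_plus_F_plus: "F_minus d k z + F_plus d k z = F_full d z"
proof -
  have parts: "(\<lambda>n. d n * z powi n) summable_on {n. n < - k}"
    "(\<lambda>n. d n * z powi n) summable_on {n. n \<ge> - k}"
    using assms summable_on_neg_part summable_on_nonneg_part by auto
  have UN: "{n. n < - k} \<union> {n. n \<ge> - k} = UNIV" by auto
  show "(\<lambda>n. d n * z powi n) summable_on UNIV"
    using summable_on_union[OF parts] by (simp add: UN)
  show "F_minus d k z + F_plus d k z = F_full d z"
    unfolding F_minus_def F_plus_def F_full_def UN[symmetric]
    by (rule infsum_Un_disjoint[symmetric]) (use parts in auto)
qed

section \<open>The second kind functions\<close>

text \<open>
  For \<open>z \<noteq> 0\<close> the vector \<^const>\<open>chi_star\<close> has the entries \<open>z powi (- 1 - cmv_exp j)\<close>; those of even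
  index form \<^const>\<open>chi1_star\<close> and those of odd index \<^const>\<open>chi2\<close>. Substituting
  \<open>n = k - cmv_exp j\<close> turns the even \<open>j\<close> into the range \<open>n \<le> k\<close> and the odd \<open>j\<close> into \<open>n > k\<close>.
\<close>

lemma
  assumes z: "z \<noteq> 0"
  shows chi1_star_sums: "(\<lambda>n. d n * z powi n) summable_on {n. n < k + 1} \<Longrightarrow>
      (\<lambda>j. d (k - cmv_exp j) * chi1_star z j) sums (z powi (- k - 1) * F_minus d (- k - 1) z)"
    and chi2_sums: "(\<lambda>n. d n * z powi n) summable_on {n. n \<ge> k + 1} \<Longrightarrow>
      (\<lambda>j. d (k - cmv_exp j) * chi2 z j) sums (z powi (- k - 1) * F_plus d (- k - 1) z)"
proof -
  have *: "(\<lambda>j. d (k - cmv_exp j) * v j) sums (z powi (- k - 1) * (\<Sum>\<^sub>\<infinity>n\<in>N. d n * z powi n))"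
    if summ: "(\<lambda>n. d n * z powi n) summable_on N"
      and bij: "bij_betw (\<lambda>j. k - cmv_exp j) J N"
      and v: "\<And>j. v j = (if j \<in> J then z powi (- 1 - cmv_exp j) else 0)" for N J v
  proof -
    let ?h = "\<lambda>n. d n * z powi n"
    have "((\<lambda>j. ?h (k - cmv_exp j)) has_sum infsum ?h N) J"
      using has_sum_reindex_bij_betw[OF bij, of ?h] has_sum_infsum[OF summ] by simp
    then have "((\<lambda>j. z powi (- k - 1) * ?h (k - cmv_exp j)) has_sum
        (z powi (- k - 1) * infsum ?h N)) J"
      by (rule has_sum_cmult_right)
    moreover have eq: "d (k - cmv_exp j) * v j = z powi (- k - 1) * ?h (k - cmv_exp j)"
      if "j \<in> J" for j
    proof -
      have "z powi (- k - 1) * z powi (k - cmv_exp j) = z powi (- 1 - cmv_exp j)"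
        using z by (simp flip: power_int_add)
      then show ?thesis using that by (simp add: v mult.left_commute)
    qed
    moreover have "((\<lambda>j. d (k - cmv_exp j) * v j) has_sum S) UNIV \<longleftrightarrow>
        ((\<lambda>j. z powi (- k - 1) * ?h (k - cmv_exp j)) has_sum S) J" for S
      by (rule has_sum_cong_neutral) (use eq in \<open>auto simp: v\<close>)
    ultimately have "((\<lambda>j. d (k - cmv_exp j) * v j) has_sum
        (z powi (- k - 1) * infsum ?h N)) UNIV"
      by blast
    then show ?thesis by (rule has_sum_imp_sums)
  qed
  show "(\<lambda>j. d (k - cmv_exp j) * chi1_star z j) sums (z powi (- k - 1) * F_minus d (- k - 1) z)"
    if "(\<lambda>n. d n * z powi n) summable_on {n. n < k + 1}"
  proof -
    have "bij_betw (\<lambda>j. k - cmv_exp j) {j. even j} {n. n < k + 1}"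
      by (rule bij_betw_byWitness[where f' = "\<lambda>n. cmv_index (k - n)"])
        (auto simp: cmv_index_def cmv_exp_def)
    from *[OF that this] show ?thesis
      by (simp add: chi1_star_eq_powi F_minus_def add.commute)
  qed
  show "(\<lambda>j. d (k - cmv_exp j) * chi2 z j) sums (z powi (- k - 1) * F_plus d (- k - 1) z)"
    if "(\<lambda>n. d n * z powi n) summable_on {n. n \<ge> k + 1}"
  proof -
    have "bij_betw (\<lambda>j. k - cmv_exp j) {j. odd j} {n. n \<ge> k + 1}"
      by (rule bij_betw_byWitness[where f' = "\<lambda>n. cmv_index (k - n)"])
        (auto simp: cmv_index_def cmv_exp_def)
    from *[OF that this] show ?thesis
      by (simp add: chi2_eq_powi F_plus_def add.commute)
  qed
qed

lemma sums_imat_vec: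
  fixes A :: imat and b v :: "nat \<Rightarrow> complex" and d F :: "int \<Rightarrow> complex" and z :: complex
  assumes row: "\<And>j. A l j = 2 * pi * (\<Sum>i\<le>l. b i * d (cmv_exp i - cmv_exp j))"
    and sums: "\<And>k. (\<lambda>j. d (k - cmv_exp j) * v j) sums (z powi (- k - 1) * F k)"
  shows "(\<lambda>j. A l j * v j) sums
    (2 * pi * (\<Sum>i\<le>l. b i * (z powi (- cmv_exp i - 1) * F (cmv_exp i))))"
proof -
  have "(\<lambda>j. 2 * pi * (\<Sum>i\<le>l. b i * (d (cmv_exp i - cmv_exp j) * v j))) sums
      (2 * pi * (\<Sum>i\<le>l. b i * (z powi (- cmv_exp i - 1) * F (cmv_exp i))))"
    by (intro sums_mult sums_sum sums)
  then show ?thesis by (simp add: row sum_distrib_right mult.assoc)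
qed

text \<open>
  The common form of the statements about the first and the second family: \<open>A\<close> supplies the second
  kind functions, \<open>B\<close> the Laurent polynomials, and \<open>d\<close> the Fourier data, conjugated for the first
  family and reflected for the second.
\<close>

lemma second_kind_functions:
  fixes A B :: imat and d :: "int \<Rightarrow> complex" and l :: nat
  assumes B: "lower_triangular_imat B"
    and row: "\<And>j. A l j = 2 * pi * (\<Sum>i\<le>l. B l i * d (cmv_exp i - cmv_exp j))"
  defines "phi \<equiv> laurent_coeff (\<lambda>z. imat_vec B (chi z) l)"
  shows "R_minus d < ereal (cmod z) \<Longrightarrow> imat_vec_converges A (chi1_star z) l \<and>
      imat_vec A (chi1_star z) l =
        2 * pi * (\<Sum>k | phi k \<noteq> 0. phi k * z powi (- k - 1) * F_minus d (- k - 1) z)"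
      (is "?c1 \<Longrightarrow> ?t1")
    and "0 < cmod z \<Longrightarrow> ereal (cmod z) < R_plus d \<Longrightarrow> imat_vec_converges A (chi2 z) l \<and>
      imat_vec A (chi2 z) l =
        2 * pi * (\<Sum>k | phi k \<noteq> 0. phi k * z powi (- k - 1) * F_plus d (- k - 1) z)"
      (is "_ \<Longrightarrow> ?c2 \<Longrightarrow> ?t2")
    and "R_minus d < ereal (cmod z) \<Longrightarrow> ereal (cmod z) < R_plus d \<Longrightarrow>
      imat_vec_converges A (chi_star z) l \<and>
      imat_vec A (chi_star z) l =
        2 * pi * imat_vec B (chi (inverse z)) l * inverse z * F_full d z"
proof -
  have phi: "(\<Sum>k | phi k \<noteq> 0. phi k * z powi (- k - 1) * F k) =
      (\<Sum>i\<le>l. B l i * (z powi (- cmv_exp i - 1) * F (cmv_exp i)))" for F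
    using sum_laurent_coeff_imat_vec_chi[OF B, of l "\<lambda>k. z powi (- k - 1) * F k"]
    by (simp add: phi_def mult.assoc)
  have 1: "(\<lambda>j. A l j * chi1_star z j) sums
      (2 * pi * (\<Sum>i\<le>l. B l i * (z powi (- cmv_exp i - 1) * F_minus d (- cmv_exp i - 1) z)))"
    if "R_minus d < ereal (cmod z)"
    using that
    by (intro sums_imat_vec[where F = "\<lambda>k. F_minus d (- k - 1) z" and d = d and A = A] row
        chi1_star_sums summable_on_neg_part) (rule R_minus_less_imp_nonzero)
  have 2: "(\<lambda>j. A l j * chi2 z j) sums
      (2 * pi * (\<Sum>i\<le>l. B l i * (z powi (- cmv_exp i - 1) * F_plus d (- cmv_exp i - 1) z)))"
    if "0 < cmod z" "ereal (cmod z) < R_plus d"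
    using that
    by (intro sums_imat_vec[where F = "\<lambda>k. F_plus d (- k - 1) z" and d = d and A = A] row
        chi2_sums summable_on_nonneg_part) auto
  show ?t1 if ?c1
    using 1[OF that] phi[of "\<lambda>k. F_minus d (- k - 1) z"]
    by (simp add: imat_vec_converges_def imat_vec_def sums_iff)
  show ?t2 if "0 < cmod z" ?c2
    using 2[OF that] phi[of "\<lambda>k. F_plus d (- k - 1) z"]
    by (simp add: imat_vec_converges_def imat_vec_def sums_iff)
  assume annulus: "R_minus d < ereal (cmod z)" "ereal (cmod z) < R_plus d"
  have z: "z \<noteq> 0" using R_minus_less_imp_nonzero[OF annulus(1)] .
  have full: "F_minus d k z = F_full d z - F_plus d k z" for k
    using F_minus_plus_F_plus[OF annulus, of k] by (simp add: eq_diff_eq)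
  have "z powi (- k - 1) = inverse z * inverse z powi k" for k
    using z by (simp add: power_int_diff powi_uminus_eq_inverse_powi divide_inverse mult.commute)
  then have Fourier_factor: "imat_vec B (chi (inverse z)) l * inverse z * F_full d z =
      (\<Sum>i\<le>l. B l i * (z powi (- cmv_exp i - 1) * F_full d z))"
    by (simp add: lower_triangular_imat_vec_chi[OF B] sum_distrib_left sum_distrib_right mult_ac)
  have "(\<lambda>j. A l j * chi_star z j) sums
      (2 * pi * (imat_vec B (chi (inverse z)) l * inverse z * F_full d z))"
    using sums_add[OF 1[OF annulus(1)] 2[OF _ annulus(2)]] z
    by (simp add: chi_star_def Fourier_factor full ring_distribs sum_subtractf)
  then show "imat_vec_converges A (chi_star z) l \<and>
      imat_vec A (chi_star z) l =
        2 * pi * imat_vec B (chi (inverse z)) l * inverse z * F_full d z"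
    by (simp add: imat_vec_converges_def imat_vec_def sums_iff mult.assoc)
qed

theorem proposition5:
  fixes \<mu> :: "complex set \<Rightarrow> complex"
  assumes "complex_measure circle_borel \<mu>"
    and "quasi_definite \<mu>"
  defines "c \<equiv> fourier_coeff \<mu>"
    and "phi1 \<equiv> \<lambda>l. laurent_coeff (cmv_phi1 \<mu> l)"
    and "phi2 \<equiv> \<lambda>l. laurent_coeff (cmv_phi2 \<mu> l)"
  shows "\<forall>l z.
    (R_minus c < ereal (cmod z) \<longrightarrow>
       imat_vec_converges (imat_dagger (imat_inv (cmv_S1 \<mu>))) (chi1_star z) l \<and>
       (\<forall>k. (\<lambda>n. conj_coeffs c n * z powi n) summable_on {n. n < - k}) \<and>
       cmv_C11 \<mu> l z =
         2 * pi * (\<Sum>k | phi2 l k \<noteq> 0.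
           phi2 l k * z powi (- k - 1) * F_minus (conj_coeffs c) (- k - 1) z)) \<and>
    (0 < cmod z \<and> ereal (cmod z) < R_plus c \<longrightarrow>
       imat_vec_converges (imat_dagger (imat_inv (cmv_S1 \<mu>))) (chi2 z) l \<and>
       (\<forall>k. (\<lambda>n. conj_coeffs c n * z powi n) summable_on {n. n \<ge> - k}) \<and>
       cmv_C12 \<mu> l z =
         2 * pi * (\<Sum>k | phi2 l k \<noteq> 0.
           phi2 l k * z powi (- k - 1) * F_plus (conj_coeffs c) (- k - 1) z)) \<and>
    (inverse (R_plus c) < ereal (cmod z) \<longrightarrow>
       imat_vec_converges (cmv_S2 \<mu>) (chi1_star z) l \<and>
       (\<forall>k. (\<lambda>n. c n * inverse z powi n) summable_on {n. n \<ge> - k}) \<and>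
       cmv_C21 \<mu> l z =
         2 * pi * (\<Sum>k | phi1 l k \<noteq> 0.
           phi1 l k * z powi (- k - 1) * F_plus c k (inverse z))) \<and>
    (0 < cmod z \<and> ereal (cmod z) < inverse (R_minus c) \<longrightarrow>
       imat_vec_converges (cmv_S2 \<mu>) (chi2 z) l \<and>
       (\<forall>k. (\<lambda>n. c n * inverse z powi n) summable_on {n. n < - k}) \<and>
       cmv_C22 \<mu> l z =
         2 * pi * (\<Sum>k | phi1 l k \<noteq> 0.
           phi1 l k * z powi (- k - 1) * F_minus c k (inverse z))) \<and>
    (R_minus c < ereal (cmod z) \<and> ereal (cmod z) < R_plus c \<longrightarrow>
       imat_vec_converges (imat_dagger (imat_inv (cmv_S1 \<mu>))) (chi_star z) l \<and>
       (\<lambda>n. conj_coeffs c n * z powi n) summable_on UNIV \<and>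
       cmv_C1 \<mu> l z =
         2 * pi * cmv_phi2 \<mu> l (inverse z) * inverse z * F_full (conj_coeffs c) z) \<and>
    (inverse (R_plus c) < ereal (cmod z) \<and> ereal (cmod z) < inverse (R_minus c) \<longrightarrow>
       imat_vec_converges (cmv_S2 \<mu>) (chi_star z) l \<and>
       (\<lambda>n. c n * inverse z powi n) summable_on UNIV \<and>
       cmv_C2 \<mu> l z =
         2 * pi * cmv_phi1 \<mu> l (inverse z) * inverse z * F_full c (inverse z))"
proof (intro allI conjI impI; (elim conjE)?)
  fix l :: nat and z :: complex
  note g = quasi_definite_sections_nonsingular[OF assms(2)]
  have S1: "lower_triangular_imat (cmv_S1 \<mu>)"
    using gauss_borel_cmv[OF g]
    by (auto simp: gauss_borel_def intro: lower_unitriangular_imp_lower_triangular)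
  have S2: "lower_triangular_imat (imat_dagger (imat_inv (cmv_S2 \<mu>)))"
    using gauss_borel_inverse(1)[OF g gauss_borel_cmv[OF g]]
    by (simp add: lower_triangular_imat_def upper_triangular_imat_def imat_dagger_def)
  note summable = summable_on_neg_part summable_on_nonneg_part
  \<comment> \<open>Row \<open>l\<close> of \<open>S2\<close> involves \<open>c\<close> at \<open>cmv_exp j - cmv_exp i\<close>, the opposite sign to the common form.\<close>
  let ?r = "\<lambda>n. c (- n)"
  have phi1: "phi1 l = laurent_coeff (\<lambda>z. imat_vec (cmv_S1 \<mu>) (chi z) l)"
    by (simp add: phi1_def cmv_phi1_def[abs_def])
  have phi2: "phi2 l =
      laurent_coeff (\<lambda>z. imat_vec (imat_dagger (imat_inv (cmv_S2 \<mu>))) (chi z) l)"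
    by (simp add: phi2_def cmv_phi2_def[abs_def])
  note kind1 = second_kind_functions[where A = "imat_dagger (imat_inv (cmv_S1 \<mu>))" and l = l
        and d = "conj_coeffs (fourier_coeff \<mu>)", OF S2 cmv_S1_inv_dagger_row[OF assms(2)],
      folded c_def phi2, unfolded R_plus_conj_coeffs R_minus_conj_coeffs]
  have "cmv_S2 \<mu> l j = 2 * pi * (\<Sum>i\<le>l. cmv_S1 \<mu> l i * ?r (cmv_exp i - cmv_exp j))" for j
    using cmv_S2_row[OF assms(2), of l j] by (simp add: c_def)
  note kind2 = second_kind_functions[where A = "cmv_S2 \<mu>" and l = l and d = ?r, OF S1 this, folded phi1,
      unfolded R_plus_reflect R_minus_reflect F_plus_reflect F_minus_reflect F_full_reflect]
  {
    assume z: "R_minus c < ereal (cmod z)"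
    show "imat_vec_converges (imat_dagger (imat_inv (cmv_S1 \<mu>))) (chi1_star z) l"
      "cmv_C11 \<mu> l z = 2 * pi * (\<Sum>k | phi2 l k \<noteq> 0.
         phi2 l k * z powi (- k - 1) * F_minus (conj_coeffs c) (- k - 1) z)"
      using kind1(1)[OF z] by (simp_all add: cmv_C11_def)
    show "(\<lambda>n. conj_coeffs c n * z powi n) summable_on {n. n < - k}" for k
      using z by (intro summable) (simp add: R_minus_conj_coeffs)
  }
  {
    assume z: "0 < cmod z" "ereal (cmod z) < R_plus c"
    show "imat_vec_converges (imat_dagger (imat_inv (cmv_S1 \<mu>))) (chi2 z) l"
      "cmv_C12 \<mu> l z = 2 * pi * (\<Sum>k | phi2 l k \<noteq> 0.
         phi2 l k * z powi (- k - 1) * F_plus (conj_coeffs c) (- k - 1) z)"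
      using kind1(2)[OF z] by (simp_all add: cmv_C12_def)
    show "(\<lambda>n. conj_coeffs c n * z powi n) summable_on {n. n \<ge> - k}" for k
      using z by (intro summable) (simp add: R_plus_conj_coeffs)
  }
  {
    assume z: "inverse (R_plus c) < ereal (cmod z)"
    show "imat_vec_converges (cmv_S2 \<mu>) (chi1_star z) l"
      "cmv_C21 \<mu> l z = 2 * pi * (\<Sum>k | phi1 l k \<noteq> 0.
         phi1 l k * z powi (- k - 1) * F_plus c k (inverse z))"
      using kind2(1)[OF z] by (simp_all add: cmv_C21_def)
    show "(\<lambda>n. c n * inverse z powi n) summable_on {n. n \<ge> - k}" for k
      using summable(1)[of ?r z "k + 1"] z
        summable_on_reindex_bij_betw[OF bij_betw_uminus_int(2)[of "- k"],
          of "\<lambda>n. c (- n) * z powi n"]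
      by (simp add: R_minus_reflect powi_uminus_eq_inverse_powi add.commute)
  }
  {
    assume z: "0 < cmod z" "ereal (cmod z) < inverse (R_minus c)"
    show "imat_vec_converges (cmv_S2 \<mu>) (chi2 z) l"
      "cmv_C22 \<mu> l z = 2 * pi * (\<Sum>k | phi1 l k \<noteq> 0.
         phi1 l k * z powi (- k - 1) * F_minus c k (inverse z))"
      using kind2(2)[OF z] by (simp_all add: cmv_C22_def)
    show "(\<lambda>n. c n * inverse z powi n) summable_on {n. n < - k}" for k
      using summable(2)[of z ?r "k + 1"] z
        summable_on_reindex_bij_betw[OF bij_betw_uminus_int(1)[of "- k"],
          of "\<lambda>n. c (- n) * z powi n"]
      by (simp add: R_plus_reflect powi_uminus_eq_inverse_powi add.commute)
  }
  {
    assume z: "R_minus c < ereal (cmod z)" "ereal (cmod z) < R_plus c"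
    show "imat_vec_converges (imat_dagger (imat_inv (cmv_S1 \<mu>))) (chi_star z) l"
      "cmv_C1 \<mu> l z =
         2 * pi * cmv_phi2 \<mu> l (inverse z) * inverse z * F_full (conj_coeffs c) z"
      using kind1(3)[OF z] by (simp_all add: cmv_C1_def cmv_phi2_def)
    show "(\<lambda>n. conj_coeffs c n * z powi n) summable_on UNIV"
      using z by (intro summable_on_annulus) (simp_all add: R_plus_conj_coeffs R_minus_conj_coeffs)
  }
  {
    assume z: "inverse (R_plus c) < ereal (cmod z)" "ereal (cmod z) < inverse (R_minus c)"
    show "imat_vec_converges (cmv_S2 \<mu>) (chi_star z) l"
      "cmv_C2 \<mu> l z = 2 * pi * cmv_phi1 \<mu> l (inverse z) * inverse z * F_full c (inverse z)"
      using kind2(3)[OF z] by (simp_all add: cmv_C2_def cmv_phi1_def)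
    show "(\<lambda>n. c n * inverse z powi n) summable_on UNIV"
      using summable_on_annulus[of ?r z] z
        summable_on_reindex_bij_betw[OF bij_betw_uminus_int_UNIV,
          of "\<lambda>n. c (- n) * z powi n"]
      by (simp add: R_plus_reflect R_minus_reflect powi_uminus_eq_inverse_powi)
  }
qed

end
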